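(* Let $f\in\mathcal{C}(\Omega)$ and $\lambda>0$, let the quadrature rule have exactness degree $2n$, and let $f^{\epsilon}=f+\epsilon$ be a noisy version of $f$, where the noise $\epsilon$ is a function in $\mathcal{C}(\Omega)$. Let $C_n=\sqrt{\max_{\mathbf{x}\in\Omega}G_n(\mathbf{x},\mathbf{x})}$, where $G_n(\mathbf{x},\mathbf{x})=\sum_{\ell=1}^{d_n}\Phi_\ell^2(\mathbf{x})$. Then $$\|\mathcal{H}_n^{\lambda}f\|_\infty\le C_nV^{1/2}\|f\|_\infty$$ and $$\|\mathcal{H}_n^{\lambda}f^{\epsilon}-f\|_\infty\le\|\mathcal{H}_n^{\lambda}f^{\epsilon}-\mathcal{L}_nf^{\epsilon}\|_\infty+(1+C_nV^{1/2})E_n(f)+C_nV^{1/2}\|\epsilon\|_\infty.$$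
   Context: $\Omega\subset\mathbb{R}^s$ is a compact smooth Riemannian manifold with smooth or empty boundary, equipped with a measure $\mathrm{d}\omega$ with $\int_\Omega \mathrm{d}\omega=V<\infty$. $\mathcal{C}(\Omega)$ is the space of continuous real functions on $\Omega$, $\langle f,g\rangle=\int_\Omega fg\,\mathrm{d}\omega$, $\|g\|_\infty=\sup_{\mathbf{x}\in\Omega}|g(\mathbf{x})|$. $\mathbb{P}_n(\Omega)$ is the space of polynomials of total degree at most $n$ restricted to $\Omega$, $d_n=\dim\mathbb{P}_n(\Omega)$, $\{\Phi_\ell\}_{\ell=1}^{d_n}$ is a fixed orthonormal basis of $\mathbb{P}_n(\Omega)$ with respect to $\langle\cdot,\cdot\rangle$, and $E_n(f)=\inf\{\|f-p\|_\infty:p\in\mathbb{P}_n(\Omega)\}$. Quadrature rule: nodes $\mathbf{x}_1,\dots,\mathbf{x}_N\in\Omega$ and weights $w_1,\dots,w_N>0$ such that $\int_\Omega p\,\mathrm{d}\omega=\sum_{j=1}^N w_jp(\mathbf{x}_j)$ for all $p\in\mathbb{P}_{2n}(\Omega)$ (exactness degree $2n$). The discrete (semi) inner product is $\langle f,g\rangle_N=\sum_{j=1}^N w_jf(\mathbf{x}_j)g(\mathbf{x}_j)$. Hyperinterpolation: $\mathcal{L}_nf=\sum_{\ell=1}^{d_n}\langle f,\Phi_\ell\rangle_N\Phi_\ell$. Hard thresholding hyperinterpolation: $\mathcal{H}_n^\lambda f=\sum_{\ell=1}^{d_n}\eta_H(\langle f,\Phi_\ell\rangle_N,\lambda)\Phi_\ell$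 for $\lambda>0$, with hard thresholding operator $\eta_H(a,k)=a$ if $|a|>k$ and $\eta_H(a,k)=0$ if $|a|\le k$. *)

theory Defs
  imports "HOL-Analysis.Analysis" "HOL-Library.Function_Algebras"
begin

section \<open>Smooth maps, submanifolds of Euclidean space, Riemannian metrics\<close>

text \<open>
  \<open>Ck_on k U f\<close>: on the open set \<open>U\<close>, all iterated directional derivatives of \<open>f\<close> of order
  less than \<open>k\<close> are differentiable, and those of order \<open>k\<close> are continuous.
\<close>

primrec Ck_on ::
  "nat \<Rightarrow> 'a::euclidean_space set \<Rightarrow> ('a \<Rightarrow> 'b::real_normed_vector) \<Rightarrow> bool" where
  "Ck_on 0 U f \<longleftrightarrow> continuous_on U f"
| "Ck_on (Suc k) U f \<longleftrightarrow>
     (\<forall>x\<in>U. f differentiable (at x)) \<and>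
     (\<forall>v. Ck_on k U (\<lambda>x. frechet_derivative f (at x) v))"

definition smooth_on ::
  "'a::euclidean_space set \<Rightarrow> ('a \<Rightarrow> 'b::real_normed_vector) \<Rightarrow> bool" where
  "smooth_on U f \<longleftrightarrow> open U \<and> (\<forall>k. Ck_on k U f)"

text \<open>
  The local models inside \<open>\<real>\<^sup>s\<close>: for \<open>J = {}\<close> the coordinate subspace spanned by the axes in \<open>I\<close>,
  and for \<open>J = {j}\<close> with \<open>j \<in> I\<close> the closed half-space \<open>y\<^sub>j \<ge> 0\<close> of that subspace.
\<close>

definition slice :: "'s set \<Rightarrow> 's set \<Rightarrow> (real^'s) set" where
  "slice I J = {y. (\<forall>i. i \<notin> I \<longrightarrow> y $ i = 0) \<and> (\<forall>j\<in>J. 0 \<le> y $ j)}"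

text \<open>
  Embedded smooth submanifold of \<open>\<real>\<^sup>s\<close> of dimension \<open>m\<close>, with smooth (possibly empty) boundary:
  locally, a diffeomorphism between open subsets of \<open>\<real>\<^sup>s\<close> straightens \<open>M\<close> to one of the models.
\<close>

definition smooth_submanifold :: "nat \<Rightarrow> (real^'s) set \<Rightarrow> bool" where
  "smooth_submanifold m M \<longleftrightarrow>
     (\<forall>x\<in>M. \<exists>U V \<phi> \<psi> (I :: 's set) J.
        x \<in> U \<and> smooth_on U \<phi> \<and> smooth_on V \<psi> \<and> homeomorphism U V \<phi> \<psi> \<and>
        card I = m \<and> J \<subseteq> I \<and> card J \<le> 1 \<and>
        \<phi> ` (M \<inter> U) = slice I J \<inter> V)"

text \<open>
  At a boundary point only a half-space of tangent vectors is realised by curves that start there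
  and stay in \<open>M\<close>; hence the linear span.
\<close>

definition tangent_space :: "(real^'s) set \<Rightarrow> real^'s \<Rightarrow> (real^'s) set" where
  "tangent_space M x =
     span {v. \<exists>\<gamma>. \<gamma> 0 = x \<and> (\<forall>t\<in>{0..1}. \<gamma> t \<in> M) \<and>
                  (\<gamma> has_vector_derivative v) (at 0 within {0..1})}"

text \<open>
  Only the values of \<open>g x\<close> on the tangent space at \<open>x\<close> matter. Smoothness (up to the boundary)
  means that \<open>g\<close> is locally the restriction of a smooth field \<open>G\<close> of bilinear forms on \<open>\<real>\<^sup>s\<close>; this
  also makes every \<open>g x\<close> bilinear on the tangent space.
\<close>

definition riemannian_metric ::
  "(real^'s) set \<Rightarrow> (real^'s \<Rightarrow> real^'s \<Rightarrow> real^'s \<Rightarrow> real) \<Rightarrow> bool" where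
  "riemannian_metric M g \<longleftrightarrow>
     (\<forall>x\<in>M. \<forall>u\<in>tangent_space M x. \<forall>v\<in>tangent_space M x. g x u v = g x v u) \<and>
     (\<forall>x\<in>M. \<forall>u\<in>tangent_space M x. u \<noteq> 0 \<longrightarrow> 0 < g x u u) \<and>
     (\<forall>x\<in>M. \<exists>U G. x \<in> U \<and> (\<forall>u v. smooth_on U (\<lambda>y. G y u v)) \<and>
        (\<forall>y\<in>U. bilinear (G y)) \<and>
        (\<forall>y\<in>M \<inter> U. \<forall>u\<in>tangent_space M y. \<forall>v\<in>tangent_space M y. g y u v = G y u v))"

definition compact_riemannian_manifold ::
  "(real^'s) set \<Rightarrow> (real^'s \<Rightarrow> real^'s \<Rightarrow> real^'s \<Rightarrow> real) \<Rightarrow> bool" where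
  "compact_riemannian_manifold M g \<longleftrightarrow>
     M \<noteq> {} \<and> compact M \<and> (\<exists>m. smooth_submanifold m M) \<and> riemannian_metric M g"


section \<open>Polynomials restricted to a set\<close>

global_interpretation fun_vs: vector_space "\<lambda>(c::real) (f::'a \<Rightarrow> real) x. c * f x"
  by unfold_locales (auto simp: fun_eq_iff algebra_simps)

text \<open>
  A function on \<open>\<Omega>\<close> is represented by its extension by zero to \<open>\<real>\<^sup>s\<close>, so that equality of
  functions, linear span and dimension are those of functions on \<open>\<Omega>\<close>.
\<close>

definition monomial_on :: "(real^'s) set \<Rightarrow> ('s \<Rightarrow> nat) \<Rightarrow> real^'s \<Rightarrow> real" where
  "monomial_on \<Omega> \<alpha> = (\<lambda>x. if x \<in> \<Omega> then \<Prod>i\<in>UNIV. (x $ i) ^ \<alpha> i else 0)"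

definition poly_space :: "(real^'s) set \<Rightarrow> nat \<Rightarrow> (real^'s \<Rightarrow> real) set" where
  "poly_space \<Omega> n = fun_vs.span (monomial_on \<Omega> ` {\<alpha>. (\<Sum>i\<in>UNIV. \<alpha> i) \<le> n})"

definition poly_dim :: "(real^'s) set \<Rightarrow> nat \<Rightarrow> nat" where
  "poly_dim \<Omega> n = fun_vs.dim (poly_space \<Omega> n)"


section \<open>Norms, inner products, best approximation\<close>

definition sup_norm :: "(real^'s) set \<Rightarrow> (real^'s \<Rightarrow> real) \<Rightarrow> real" where
  "sup_norm \<Omega> g = (SUP x\<in>\<Omega>. \<bar>g x\<bar>)"

definition best_approx_error :: "(real^'s) set \<Rightarrow> nat \<Rightarrow> (real^'s \<Rightarrow> real) \<Rightarrow> real" where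
  "best_approx_error \<Omega> n f = (INF p\<in>poly_space \<Omega> n. sup_norm \<Omega> (\<lambda>x. f x - p x))"

definition inner_prod ::
  "(real^'s) measure \<Rightarrow> (real^'s \<Rightarrow> real) \<Rightarrow> (real^'s \<Rightarrow> real) \<Rightarrow> real" where
  "inner_prod \<omega> f g = (LINT x|\<omega>. f x * g x)"

definition orthonormal_poly_basis ::
  "(real^'s) set \<Rightarrow> (real^'s) measure \<Rightarrow> nat \<Rightarrow> (nat \<Rightarrow> real^'s \<Rightarrow> real) \<Rightarrow> bool" where
  "orthonormal_poly_basis \<Omega> \<omega> n \<Phi> \<longleftrightarrow>
     fun_vs.span (\<Phi> ` {1..poly_dim \<Omega> n}) = poly_space \<Omega> n \<and>
     (\<forall>k\<in>{1..poly_dim \<Omega> n}. \<forall>l\<in>{1..poly_dim \<Omega> n}.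
        inner_prod \<omega> (\<Phi> k) (\<Phi> l) = (if k = l then 1 else 0))"

definition quadrature_exact ::
  "(real^'s) set \<Rightarrow> (real^'s) measure \<Rightarrow> nat \<Rightarrow> nat \<Rightarrow> (nat \<Rightarrow> real) \<Rightarrow> (nat \<Rightarrow> real^'s) \<Rightarrow> bool" where
  "quadrature_exact \<Omega> \<omega> m N w x \<longleftrightarrow>
     (\<forall>p\<in>poly_space \<Omega> m. (LINT y|\<omega>. p y) = (\<Sum>j=1..N. w j * p (x j)))"

definition discrete_inner ::
  "nat \<Rightarrow> (nat \<Rightarrow> real) \<Rightarrow> (nat \<Rightarrow> real^'s) \<Rightarrow> (real^'s \<Rightarrow> real) \<Rightarrow> (real^'s \<Rightarrow> real) \<Rightarrow> real" where
  "discrete_inner N w x f g = (\<Sum>j=1..N. w j * f (x j) * g (x j))"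


section \<open>Hyperinterpolation and hard thresholding\<close>

text \<open>
  In the two operators, \<open>d\<close> is the number of basis functions, \<open>N\<close>, \<open>w\<close>, \<open>x\<close> are the number of
  nodes, the weights and the nodes of the quadrature rule.
\<close>

definition hyperinterp ::
  "nat \<Rightarrow> (nat \<Rightarrow> real^'s \<Rightarrow> real) \<Rightarrow> nat \<Rightarrow> (nat \<Rightarrow> real) \<Rightarrow> (nat \<Rightarrow> real^'s) \<Rightarrow>
   (real^'s \<Rightarrow> real) \<Rightarrow> real^'s \<Rightarrow> real" where
  "hyperinterp d \<Phi> N w x f = (\<lambda>y. \<Sum>l=1..d. discrete_inner N w x f (\<Phi> l) * \<Phi> l y)"

definition hard_threshold :: "real \<Rightarrow> real \<Rightarrow> real" where
  "hard_threshold a k = (if \<bar>a\<bar> > k then a else 0)"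

definition hard_hyperinterp ::
  "real \<Rightarrow> nat \<Rightarrow> (nat \<Rightarrow> real^'s \<Rightarrow> real) \<Rightarrow> nat \<Rightarrow> (nat \<Rightarrow> real) \<Rightarrow> (nat \<Rightarrow> real^'s) \<Rightarrow>
   (real^'s \<Rightarrow> real) \<Rightarrow> real^'s \<Rightarrow> real" where
  "hard_hyperinterp lam d \<Phi> N w x f =
     (\<lambda>y. \<Sum>l=1..d. hard_threshold (discrete_inner N w x f (\<Phi> l)) lam * \<Phi> l y)"

text \<open>
  The supremum below is a maximum when \<open>\<Omega>\<close> is compact and nonempty and the basis functions are
  continuous on \<open>\<Omega>\<close>.
\<close>

definition kernel_const :: "(real^'s) set \<Rightarrow> nat \<Rightarrow> (nat \<Rightarrow> real^'s \<Rightarrow> real) \<Rightarrow> real" where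
  "kernel_const \<Omega> d \<Phi> = sqrt (SUP y\<in>\<Omega>. \<Sum>l=1..d. (\<Phi> l y)\<^sup>2)"

end

theory Submission
  imports Defs
begin

text \<open>
  Products of two basis functions have degree at most \<open>2 n\<close>, so exactness makes the basis
  orthonormal for the discrete inner product as well. Hence \<open>L\<close> is the identity on polynomials of
  degree at most \<open>n\<close>, and Bessel's inequality bounds the sum of the squared coefficients by
  \<open>\<langle>f, f\<rangle>\<^sub>N\<close>, which is at most \<open>V \<parallel>f\<parallel>\<^sup>2\<close> since the weights sum to \<open>V\<close>. Thresholding only
  decreases coefficients in absolute value, so Cauchy-Schwarz against the kernel bounds \<open>L\<close> and
  \<open>H\<close> alike. For the second estimate, for every polynomial \<open>p\<close> of degree at most \<open>n\<close>,
  \<open>H f\<epsilon> - f = (H f\<epsilon> - L f\<epsilon>) + L (f - p) + L \<epsilon> - (f - p)\<close>.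
\<close>

section \<open>Algebra and continuity of restricted polynomials\<close>

lemma monomial_on_mult:
  "monomial_on \<Omega> \<alpha> y * monomial_on \<Omega> \<beta> y = monomial_on \<Omega> (\<lambda>i. \<alpha> i + \<beta> i) y"
  by (simp add: monomial_on_def power_add prod.distrib)

lemma monomial_on_in_poly_space:
  "(\<Sum>i\<in>UNIV. \<alpha> i) \<le> n \<Longrightarrow> monomial_on \<Omega> \<alpha> \<in> poly_space \<Omega> n"
  unfolding poly_space_def by (auto intro: fun_vs.span_base)

lemma poly_space_add:
  assumes "p \<in> poly_space \<Omega> n" "q \<in> poly_space \<Omega> n"
  shows "(\<lambda>y. p y + q y) \<in> poly_space \<Omega> n"
  using fun_vs.span_add[of p _ q] assms unfolding poly_space_def plus_fun_def by blast

lemma poly_space_scale: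
  assumes "p \<in> poly_space \<Omega> n"
  shows "(\<lambda>y. c * p y) \<in> poly_space \<Omega> n"
  using assms fun_vs.span_scale[of p] unfolding poly_space_def by blast

lemma zero_in_poly_space: "(\<lambda>y. 0) \<in> poly_space \<Omega> n"
  using fun_vs.span_zero unfolding poly_space_def zero_fun_def by blast

text \<open>Span induction with the closure conditions written pointwise, so that they match lambda
  terms directly instead of sums and zero in the function algebra.\<close>

lemma span_fun_induct [consumes 1, case_names base zero add scale]:
  fixes p :: "'a \<Rightarrow> real"
  assumes "p \<in> fun_vs.span B"
    and base: "\<And>b. b \<in> B \<Longrightarrow> P b"
    and zero: "P (\<lambda>y. 0)"
    and add: "\<And>p q. P p \<Longrightarrow> P q \<Longrightarrow> P (\<lambda>y. p y + q y)"
    and scale: "\<And>c p. P p \<Longrightarrow> P (\<lambda>y. c * p y)"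
  shows "P p"
  using assms(1)
proof (rule fun_vs.span_induct)
  show "fun_vs.subspace (Collect P)"
    using zero add scale by (auto simp: fun_vs.subspace_def plus_fun_def zero_fun_def)
qed (use base in auto)

text \<open>By bilinearity it suffices to multiply monomials, whose exponents add. Induction over
  the span of \<open>q\<close> with a fixed monomial on the left comes first, then induction over
  the span of \<open>p\<close>.\<close>

lemma poly_space_mult:
  assumes "p \<in> poly_space \<Omega> m" "q \<in> poly_space \<Omega> n"
  shows "(\<lambda>y. p y * q y) \<in> poly_space \<Omega> (m + n)"
proof -
  have mono: "(\<lambda>y. monomial_on \<Omega> \<alpha> y * q y) \<in> poly_space \<Omega> (m + n)"
    if "(\<Sum>i\<in>UNIV. \<alpha> i) \<le> m" for \<alpha>
    using assms(2)[unfolded poly_space_def]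
  proof (induction rule: span_fun_induct)
    case (base b)
    then obtain \<beta> where \<beta>: "b = monomial_on \<Omega> \<beta>" "(\<Sum>i\<in>UNIV. \<beta> i) \<le> n" by auto
    show ?case unfolding \<beta>(1) monomial_on_mult
      using that \<beta>(2) by (intro monomial_on_in_poly_space) (simp add: sum.distrib)
  next
    case (scale c p)
    then show ?case using poly_space_scale[of _ _ _ c] by (simp add: mult.left_commute)
  qed (use zero_in_poly_space in \<open>auto simp: distrib_left intro: poly_space_add\<close>)
  show ?thesis
    using assms(1)[unfolded poly_space_def]
  proof (induction rule: span_fun_induct)
    case (scale c p)
    then show ?case using poly_space_scale[of _ _ _ c] by (simp add: mult.assoc)
  qed (use mono zero_in_poly_space in \<open>auto simp: distrib_right intro: poly_space_add\<close>)
qed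

lemma continuous_on_poly_space:
  assumes "p \<in> poly_space \<Omega> n"
  shows "continuous_on \<Omega> p"
  using assms unfolding poly_space_def
proof (induction rule: span_fun_induct)
  case (base b)
  then obtain \<beta> where \<beta>: "b = monomial_on \<Omega> \<beta>" by auto
  \<comment> \<open>The cut-off to zero outside \<open>\<Omega>\<close> is invisible to continuity
    on \<open>\<Omega>\<close>, so the uncut monomial can replace \<open>b\<close>.\<close>
  have "continuous_on \<Omega> (\<lambda>y::real^'a. \<Prod>i\<in>UNIV. (y $ i) ^ \<beta> i)"
    by (intro continuous_intros)
  then show ?case
    by (rule continuous_on_eq) (simp add: \<beta> monomial_on_def)
qed (auto intro!: continuous_intros)

text \<open>This is the constant 1 in the extension-by-zero encoding, the monomial with all
  exponents 0. Exactness applied to it yields the sum of the weights.\<close>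

lemma indicator_in_poly_space: "(\<lambda>y. if y \<in> \<Omega> then 1 else 0) \<in> poly_space \<Omega> n"
  using monomial_on_in_poly_space[of "\<lambda>_. 0" n \<Omega>] by (simp add: monomial_on_def cong: if_cong)

section \<open>Supremum norm on a compact set\<close>

lemma bdd_above_abs_continuous_image:
  fixes h :: "'a::topological_space \<Rightarrow> real"
  assumes "compact S" "continuous_on S h"
  shows "bdd_above ((\<lambda>y. \<bar>h y\<bar>) ` S)"
  using assms
  by (intro bounded_imp_bdd_above compact_imp_bounded compact_continuous_image continuous_intros)

lemma abs_le_sup_norm:
  assumes "compact \<Omega>" "continuous_on \<Omega> h" "y \<in> \<Omega>"
  shows "\<bar>h y\<bar> \<le> sup_norm \<Omega> h"
  unfolding sup_norm_def
  using assms by (intro cSUP_upper bdd_above_abs_continuous_image)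

lemma sup_norm_nonneg:
  assumes "compact \<Omega>" "\<Omega> \<noteq> {}" "continuous_on \<Omega> h"
  shows "0 \<le> sup_norm \<Omega> h"
  using assms abs_le_sup_norm[OF assms(1,3)] by (meson abs_ge_zero ex_in_conv order_trans)

lemma sup_norm_least:
  assumes "\<Omega> \<noteq> {}" "\<And>y. y \<in> \<Omega> \<Longrightarrow> \<bar>h y\<bar> \<le> b"
  shows "sup_norm \<Omega> h \<le> b"
  unfolding sup_norm_def using assms by (intro cSUP_least) auto

section \<open>Discrete inner product, hyperinterpolation and Bessel's inequality\<close>

lemma discrete_inner_commute: "discrete_inner N w x h k = discrete_inner N w x k h"
  unfolding discrete_inner_def by (simp add: mult_ac)

lemma discrete_inner_add_left:
  "discrete_inner N w x (\<lambda>y. h y + k y) q = discrete_inner N w x h q + discrete_inner N w x k q"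
  unfolding discrete_inner_def by (simp add: algebra_simps sum.distrib)

lemma discrete_inner_scale_left:
  "discrete_inner N w x (\<lambda>y. c * h y) q = c * discrete_inner N w x h q"
  unfolding discrete_inner_def by (simp add: sum_distrib_left mult_ac)

text \<open>Interchanging the sums over nodes and basis functions gives an expression symmetric in
  \<open>f\<close> and \<open>h\<close>: hyperinterpolation is self-adjoint for the discrete inner
  product.\<close>

lemma discrete_inner_hyperinterp:
  "discrete_inner N w x h (hyperinterp d \<Phi> N w x f) =
    (\<Sum>l=1..d. discrete_inner N w x f (\<Phi> l) * discrete_inner N w x h (\<Phi> l))"
proof -
  have "discrete_inner N w x h (hyperinterp d \<Phi> N w x f) =
      (\<Sum>j=1..N. \<Sum>l=1..d. w j * h (x j) * (discrete_inner N w x f (\<Phi> l) * \<Phi> l (x j)))"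
    unfolding discrete_inner_def[of N w x h] hyperinterp_def by (simp add: sum_distrib_left)
  also have "\<dots> = (\<Sum>l=1..d. \<Sum>j=1..N. discrete_inner N w x f (\<Phi> l) * (w j * h (x j) * \<Phi> l (x j)))"
    by (subst sum.swap) (simp add: mult_ac)
  finally show ?thesis
    by (simp add: discrete_inner_def[of N w x h] sum_distrib_left)
qed

lemma hyperinterp_add:
  "hyperinterp d \<Phi> N w x (\<lambda>y. h y + k y) y = hyperinterp d \<Phi> N w x h y + hyperinterp d \<Phi> N w x k y"
  unfolding hyperinterp_def by (simp add: discrete_inner_add_left algebra_simps sum.distrib)

lemma hyperinterp_scale:
  "hyperinterp d \<Phi> N w x (\<lambda>y. c * h y) y = c * hyperinterp d \<Phi> N w x h y"
  unfolding hyperinterp_def by (simp add: discrete_inner_scale_left sum_distrib_left mult_ac)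

definition discretely_orthonormal ::
  "nat \<Rightarrow> (nat \<Rightarrow> real) \<Rightarrow> (nat \<Rightarrow> real^'s) \<Rightarrow> nat \<Rightarrow> (nat \<Rightarrow> real^'s \<Rightarrow> real) \<Rightarrow> bool" where
  "discretely_orthonormal N w x d \<Phi> \<longleftrightarrow>
    (\<forall>k\<in>{1..d}. \<forall>l\<in>{1..d}. discrete_inner N w x (\<Phi> k) (\<Phi> l) = (if k = l then 1 else 0))"

lemma hyperinterp_basis:
  assumes "discretely_orthonormal N w x d \<Phi>" "k \<in> {1..d}"
  shows "hyperinterp d \<Phi> N w x (\<Phi> k) = \<Phi> k"
proof
  fix y
  have "hyperinterp d \<Phi> N w x (\<Phi> k) y = (\<Sum>l=1..d. if k = l then \<Phi> l y else 0)"
    unfolding hyperinterp_def using assms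
    by (intro sum.cong) (auto simp: discretely_orthonormal_def)
  then show "hyperinterp d \<Phi> N w x (\<Phi> k) y = \<Phi> k y"
    using assms(2) by simp
qed

text \<open>The operator is linear and fixes each basis function, hence it fixes their span.\<close>

lemma hyperinterp_span:
  assumes "discretely_orthonormal N w x d \<Phi>" "p \<in> fun_vs.span (\<Phi> ` {1..d})"
  shows "hyperinterp d \<Phi> N w x p = p"
  using assms(2)
proof (induction rule: span_fun_induct)
  case (base b)
  then show ?case using hyperinterp_basis[OF assms(1)] by auto
next
  case zero
  show ?case by (simp add: hyperinterp_def discrete_inner_def)
qed (simp_all add: fun_eq_iff hyperinterp_add hyperinterp_scale)

text \<open>Nonnegative weights make the discrete seminorm of \<open>f - ?L\<close> nonnegative. In
  the expansion of its square, the cross term and the square of \<open>?L\<close> both reduce to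
  \<open>?S\<close>.\<close>

lemma discrete_bessel:
  assumes "discretely_orthonormal N w x d \<Phi>" and w: "\<And>j. j \<in> {1..N} \<Longrightarrow> 0 \<le> w j"
  shows "(\<Sum>l=1..d. (discrete_inner N w x f (\<Phi> l))\<^sup>2) \<le> discrete_inner N w x f f"
proof -
  let ?L = "hyperinterp d \<Phi> N w x f"
  let ?S = "\<Sum>l=1..d. (discrete_inner N w x f (\<Phi> l))\<^sup>2"
  have fL: "discrete_inner N w x f ?L = ?S"
    by (simp add: discrete_inner_hyperinterp power2_eq_square)
  \<comment> \<open>Self-adjointness moves the operator onto \<open>\<Phi> k\<close>, which it
    fixes.\<close>
  have "discrete_inner N w x ?L (\<Phi> k) = discrete_inner N w x f (\<Phi> k)" if "k \<in> {1..d}" for k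
  proof -
    have "discrete_inner N w x ?L (\<Phi> k) = discrete_inner N w x f (hyperinterp d \<Phi> N w x (\<Phi> k))"
      by (subst discrete_inner_commute) (simp add: discrete_inner_hyperinterp mult_ac)
    then show ?thesis by (simp only: hyperinterp_basis[OF assms(1) that])
  qed
  then have LL: "discrete_inner N w x ?L ?L = ?S"
    by (simp add: discrete_inner_hyperinterp power2_eq_square)
  have "0 \<le> (\<Sum>j=1..N. w j * (f (x j) - ?L (x j))\<^sup>2)"
    using w by (intro sum_nonneg) auto
  also have "\<dots> = discrete_inner N w x f f - 2 * discrete_inner N w x f ?L + discrete_inner N w x ?L ?L"
    unfolding discrete_inner_def[of N w x f f] discrete_inner_def[of N w x f ?L]
      discrete_inner_def[of N w x ?L ?L]
    by (simp add: power2_eq_square algebra_simps sum.distrib sum_subtractf sum_distrib_left)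
  finally show ?thesis using fL LL by simp
qed

section \<open>Bounds for discrete energy and kernel\<close>

lemma discrete_inner_self_le:
  assumes w: "\<And>j. j \<in> {1..N} \<Longrightarrow> 0 \<le> w j"
    and h: "\<And>j. j \<in> {1..N} \<Longrightarrow> \<bar>h (x j)\<bar> \<le> b"
  shows "discrete_inner N w x h h \<le> (\<Sum>j=1..N. w j) * b\<^sup>2"
  unfolding discrete_inner_def sum_distrib_right
proof (rule sum_mono)
  fix j assume j: "j \<in> {1..N}"
  have "h (x j) * h (x j) \<le> b\<^sup>2"
    using power_mono[OF h[OF j], of 2] by (simp add: power2_eq_square)
  then show "w j * h (x j) * h (x j) \<le> w j * b\<^sup>2"
    using w[OF j] by (simp add: mult.assoc mult_left_mono)
qed

text \<open>Cauchy-Schwarz in the index \<open>l\<close> separates coefficients from kernel. The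
  coefficients stay arbitrary, so that thresholded and plain ones are both covered.\<close>

lemma abs_sum_le_kernel_const:
  assumes "bdd_above ((\<lambda>y. \<Sum>l=1..d. (\<Phi> l y)\<^sup>2) ` \<Omega>)" "y \<in> \<Omega>"
    and "(\<Sum>l=1..d. (b l)\<^sup>2) \<le> K"
  shows "\<bar>\<Sum>l=1..d. b l * \<Phi> l y\<bar> \<le> kernel_const \<Omega> d \<Phi> * sqrt K"
proof -
  have G: "(\<Sum>l=1..d. (\<Phi> l y)\<^sup>2) \<le> (SUP y\<in>\<Omega>. \<Sum>l=1..d. (\<Phi> l y)\<^sup>2)"
    using assms by (intro cSUP_upper)
  have "\<bar>\<Sum>l=1..d. b l * \<Phi> l y\<bar> = sqrt ((\<Sum>l=1..d. b l * \<Phi> l y)\<^sup>2)" by simp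
  also have "\<dots> \<le> sqrt ((\<Sum>l=1..d. (b l)\<^sup>2) * (\<Sum>l=1..d. (\<Phi> l y)\<^sup>2))"
    by (intro real_sqrt_le_mono Cauchy_Schwarz_ineq_sum)
  also have "\<dots> \<le> sqrt (K * (SUP y\<in>\<Omega>. \<Sum>l=1..d. (\<Phi> l y)\<^sup>2))"
    \<comment> \<open>Multiplying the two inequalities requires \<open>0 \<le> K\<close>, which
      follows because \<open>K\<close> dominates a sum of squares.\<close>
    using G assms(3) order_trans[OF sum_nonneg assms(3)]
    by (intro real_sqrt_le_mono mult_mono) (auto intro: sum_nonneg)
  finally show ?thesis
    by (simp add: kernel_const_def real_sqrt_mult mult.commute)
qed

text \<open>Zero coefficients with \<open>K = 1\<close> turn the preceding estimate into the
  claim.\<close>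

lemma kernel_const_nonneg:
  assumes "bdd_above ((\<lambda>y. \<Sum>l=1..d. (\<Phi> l y)\<^sup>2) ` \<Omega>)" "\<Omega> \<noteq> {}"
  shows "0 \<le> kernel_const \<Omega> d \<Phi>"
proof -
  obtain y where "y \<in> \<Omega>" using assms(2) by auto
  then show ?thesis
    using abs_sum_le_kernel_const[OF assms(1), of y "\<lambda>_. 0" 1] by simp
qed

section \<open>Stability and error estimates\<close>

theorem theorem4p3:
  fixes \<Omega> :: "(real^'s) set"
    and g :: "real^'s \<Rightarrow> real^'s \<Rightarrow> real^'s \<Rightarrow> real"
    and \<omega> :: "(real^'s) measure"
    and V :: real
    and n N :: nat
    and \<Phi> :: "nat \<Rightarrow> real^'s \<Rightarrow> real"
    and x :: "nat \<Rightarrow> real^'s"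
    and w :: "nat \<Rightarrow> real"
    and f \<epsilon> :: "real^'s \<Rightarrow> real"
    and lam :: real
  assumes manifold: "compact_riemannian_manifold \<Omega> g"
    and measure: "sets \<omega> = sets (restrict_space borel \<Omega>)" "finite_measure \<omega>"
    and V: "(LINT y|\<omega>. 1) = V"
    and basis: "orthonormal_poly_basis \<Omega> \<omega> n \<Phi>"
    and nodes: "\<And>j. j \<in> {1..N} \<Longrightarrow> x j \<in> \<Omega>"
    and weights: "\<And>j. j \<in> {1..N} \<Longrightarrow> w j > 0"
    and exact: "quadrature_exact \<Omega> \<omega> (2 * n) N w x"
    and f: "continuous_on \<Omega> f"
    and noise: "continuous_on \<Omega> \<epsilon>"
    and lam: "lam > 0"
  defines "d \<equiv> poly_dim \<Omega> n"
    and "f\<epsilon> \<equiv> (\<lambda>y. f y + \<epsilon> y)"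
  defines "C \<equiv> kernel_const \<Omega> d \<Phi>"
    and "L \<equiv> hyperinterp d \<Phi> N w x"
    and "H \<equiv> hard_hyperinterp lam d \<Phi> N w x"
  shows "sup_norm \<Omega> (H f) \<le> C * sqrt V * sup_norm \<Omega> f
       \<and> sup_norm \<Omega> (\<lambda>y. H f\<epsilon> y - f y)
           \<le> sup_norm \<Omega> (\<lambda>y. H f\<epsilon> y - L f\<epsilon> y)
             + (1 + C * sqrt V) * best_approx_error \<Omega> n f
             + C * sqrt V * sup_norm \<Omega> \<epsilon>"
proof -
  have ne: "\<Omega> \<noteq> {}" and cpt: "compact \<Omega>"
    using manifold by (auto simp: compact_riemannian_manifold_def)
  have space: "space \<omega> = \<Omega>"
    using sets_eq_imp_space_eq[OF measure(1)] by (simp add: space_restrict_space)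
  have span: "fun_vs.span (\<Phi> ` {1..d}) = poly_space \<Omega> n"
    using basis by (simp add: orthonormal_poly_basis_def d_def)
  have \<Phi>: "\<Phi> l \<in> poly_space \<Omega> n" if "l \<in> {1..d}" for l
    using that unfolding span[symmetric] by (auto intro: fun_vs.span_base)
  have cont\<Phi>: "continuous_on \<Omega> (\<Phi> l)" if "l \<in> {1..d}" for l
    using \<Phi>[OF that] by (rule continuous_on_poly_space)
  have on: "discretely_orthonormal N w x d \<Phi>"
    unfolding discretely_orthonormal_def
  proof (intro ballI)
    fix k l assume kl: "k \<in> {1..d}" "l \<in> {1..d}"
    have "(\<lambda>y. \<Phi> k y * \<Phi> l y) \<in> poly_space \<Omega> (2 * n)"
      using poly_space_mult[OF \<Phi>[OF kl(1)] \<Phi>[OF kl(2)]] by (simp add: mult_2)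
    then have "discrete_inner N w x (\<Phi> k) (\<Phi> l) = inner_prod \<omega> (\<Phi> k) (\<Phi> l)"
      using exact by (auto simp: quadrature_exact_def discrete_inner_def inner_prod_def mult.assoc)
    then show "discrete_inner N w x (\<Phi> k) (\<Phi> l) = (if k = l then 1 else 0)"
      using basis kl by (simp add: orthonormal_poly_basis_def d_def)
  qed
  \<comment> \<open>The constant 1 enters exactness only through its extension by zero. Both sides
    are unaffected, since the nodes lie in \<open>\<Omega>\<close> and \<open>\<Omega>\<close> is
    the whole space of \<open>\<omega>\<close>.\<close>
  have "(\<Sum>j=1..N. w j) = (\<Sum>j=1..N. w j * (if x j \<in> \<Omega> then 1 else 0))"
    using nodes by (intro sum.cong) auto
  also have "\<dots> = (LINT y|\<omega>. (if y \<in> \<Omega> then 1 else 0))"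
    using bspec[OF exact[unfolded quadrature_exact_def] indicator_in_poly_space] by (rule sym)
  also have "\<dots> = V"
    unfolding V[symmetric] by (rule Bochner_Integration.integral_cong) (auto simp: space)
  finally have sum_w: "(\<Sum>j=1..N. w j) = V" .
  have bddG: "bdd_above ((\<lambda>y. \<Sum>l=1..d. (\<Phi> l y)\<^sup>2) ` \<Omega>)"
    using cpt cont\<Phi>
    by (intro bounded_imp_bdd_above compact_imp_bounded compact_continuous_image continuous_intros)
  have V0: "0 \<le> V" unfolding sum_w[symmetric] using weights by (intro sum_nonneg) (simp add: less_imp_le)
  have C0: "0 \<le> C" unfolding C_def by (rule kernel_const_nonneg[OF bddG ne])
  \<comment> \<open>One bound serves both operators: \<open>b\<close> is any family dominated by the
    discrete coefficients of \<open>h\<close>, to be instantiated with the thresholded coefficients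
    for \<open>H\<close> and with the coefficients themselves for \<open>L\<close>.\<close>
  have coeff: "\<bar>\<Sum>l=1..d. b l * \<Phi> l y\<bar> \<le> C * sqrt V * sup_norm \<Omega> h"
    if h: "continuous_on \<Omega> h" and y: "y \<in> \<Omega>"
      and b: "\<And>l. \<bar>b l\<bar> \<le> \<bar>discrete_inner N w x h (\<Phi> l)\<bar>" for b h y
  proof -
    have "(\<Sum>l=1..d. (b l)\<^sup>2) \<le> (\<Sum>l=1..d. (discrete_inner N w x h (\<Phi> l))\<^sup>2)"
      using b by (intro sum_mono) (simp add: abs_le_square_iff)
    also have "\<dots> \<le> discrete_inner N w x h h"
      using weights by (intro discrete_bessel[OF on]) (simp add: less_imp_le)
    also have "\<dots> \<le> V * (sup_norm \<Omega> h)\<^sup>2"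
      unfolding sum_w[symmetric] using weights nodes abs_le_sup_norm[OF cpt h]
      by (intro discrete_inner_self_le) (auto simp: less_imp_le)
    finally show ?thesis
      using abs_sum_le_kernel_const[OF bddG y, of b "V * (sup_norm \<Omega> h)\<^sup>2"]
        sup_norm_nonneg[OF cpt ne h]
      by (simp add: C_def real_sqrt_mult mult.assoc)
  qed
  have H_bound: "\<bar>H h y\<bar> \<le> C * sqrt V * sup_norm \<Omega> h" if "continuous_on \<Omega> h" "y \<in> \<Omega>" for h y
    unfolding H_def hard_hyperinterp_def using that by (rule coeff) (simp add: hard_threshold_def)
  have L_bound: "\<bar>L h y\<bar> \<le> C * sqrt V * sup_norm \<Omega> h" if "continuous_on \<Omega> h" "y \<in> \<Omega>" for h y
    unfolding L_def hyperinterp_def using that by (rule coeff) simp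
  have contHL: "continuous_on \<Omega> (\<lambda>y. H f\<epsilon> y - L f\<epsilon> y)"
    unfolding H_def L_def hard_hyperinterp_def hyperinterp_def
    using cont\<Phi> by (intro continuous_intros)
  let ?c = "C * sqrt V"
  have c0: "0 \<le> ?c" using C0 V0 by simp
  let ?A = "sup_norm \<Omega> (\<lambda>y. H f\<epsilon> y - f y)"
  \<comment> \<open>\<open>?R\<close> collects the terms that do not depend on the approximating
    polynomial, leaving one term for the infimum. The factor \<open>1 + ?c\<close> there combines
    \<open>f - p\<close> itself with its image under \<open>L\<close>.\<close>
  let ?R = "sup_norm \<Omega> (\<lambda>y. H f\<epsilon> y - L f\<epsilon> y) + ?c * sup_norm \<Omega> \<epsilon>"
  have approx: "?A \<le> ?R + (1 + ?c) * sup_norm \<Omega> (\<lambda>y. f y - p y)" if p: "p \<in> poly_space \<Omega> n" for p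
  proof (rule sup_norm_least[OF ne])
    fix y assume y: "y \<in> \<Omega>"
    let ?h = "\<lambda>y. f y - p y"
    have h: "continuous_on \<Omega> ?h"
      using f continuous_on_poly_space[OF p] by (intro continuous_intros)
    have "L p = p"
      unfolding L_def using on p[folded span] by (rule hyperinterp_span)
    moreover have "L f\<epsilon> y = L (\<lambda>y. ?h y + p y) y + L \<epsilon> y"
      by (simp add: f\<epsilon>_def L_def hyperinterp_add)
    ultimately have "L f\<epsilon> y = L ?h y + p y + L \<epsilon> y"
      unfolding L_def hyperinterp_add by simp
    then have "H f\<epsilon> y - f y = (H f\<epsilon> y - L f\<epsilon> y) + L ?h y + L \<epsilon> y - ?h y" by simp
    moreover have "\<bar>H f\<epsilon> y - L f\<epsilon> y\<bar> \<le> sup_norm \<Omega> (\<lambda>y. H f\<epsilon> y - L f\<epsilon> y)"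
      using abs_le_sup_norm[OF cpt contHL y] .
    moreover note L_bound[OF h y] L_bound[OF noise y] abs_le_sup_norm[OF cpt h y]
    ultimately show "\<bar>H f\<epsilon> y - f y\<bar> \<le> ?R + (1 + ?c) * sup_norm \<Omega> ?h"
      unfolding distrib_right by linarith
  qed
  \<comment> \<open>Since \<open>1 + ?c\<close> is positive, \<open>approx\<close> can be solved for
    the distance from \<open>f\<close> to \<open>p\<close>. This gives a lower bound uniform in
    \<open>p\<close>, hence one for the infimum, whether or not it is attained.\<close>
  have "(?A - ?R) / (1 + ?c) \<le> best_approx_error \<Omega> n f"
    unfolding best_approx_error_def
  proof (rule cINF_greatest)
    show "poly_space \<Omega> n \<noteq> {}" using zero_in_poly_space by auto
    show "(?A - ?R) / (1 + ?c) \<le> sup_norm \<Omega> (\<lambda>y. f y - p y)" if "p \<in> poly_space \<Omega> n" for p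
      using approx[OF that] c0 by (simp add: pos_divide_le_eq mult.commute)
  qed
  then have "?A \<le> ?R + (1 + ?c) * best_approx_error \<Omega> n f"
    using c0 by (simp add: pos_divide_le_eq mult.commute)
  moreover have "sup_norm \<Omega> (H f) \<le> ?c * sup_norm \<Omega> f"
    using H_bound[OF f] by (rule sup_norm_least[OF ne])
  ultimately show ?thesis by simp
qed

end
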